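(* Let $V,b:\mathbb{T}\to\mathbb{R}$ be smooth with $\int_{\mathbb{T}}b\,dx=0$, and let $(u^*,m^*,\overline{H}^* )$ be the (unique smooth) solution of $$\frac{u_x^2}{2}+V(x)+b(x)u_x=\ln m+\overline{H},\quad -(m(u_x+b(x)))_x=0\ \text{ on }\mathbb{T},\quad \int_{\mathbb{T}}m\,dx=1,\ \int_{\mathbb{T}}u\,dx=0 .$$ Then there exists a sequence $\{(N_i,\gamma_i)\}_{i=1}^\infty$ (with $N_i\in\mathbb{N}$, $\gamma_i>0$) such that any minimizer $(u^i,m^i,\overline{H}^i)$ of $$\min_{u\in\mathcal{G}^{N_i},\ m\in\mathcal{G}^{N_i},\ \overline{H}\in\mathbb{R}}J_{\gamma_i}(u,m,\overline{H})$$ satisfies $u^i\to u^*$ in $H^1(\mathbb{T})$, $m^i\to m^*$ in $L^1(\mathbb{T})$, and $\overline{H}^i\to\overline{H}^*$ in $\mathbb{R}$ as $i\to\infty$.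
   Context: $\mathbb{T}$ is the one-dimensional torus, identified with $[0,1)$. $H(x,p):=V(x)+\frac{p^2}{2}+b(x)p$. Under $\int_{\mathbb{T}}b\,dx=0$ the mean field game system in the claim is known to have a unique smooth solution. For $N\in\mathbb{N}$, $$\mathcal{G}^N=\Big\{\phi\ \Big|\ \phi(x)=c+\sum_{i=1}^N\alpha_i\sin(2\pi ix)+\sum_{i=1}^N\beta_i\cos(2\pi ix),\ c,\alpha_i,\beta_i\in\mathbb{R}\Big\}.$$ For $\gamma>0$, $$J_\gamma(u,m,\overline{H})=\int_{\mathbb{T}}|u|^2dx+\int_{\mathbb{T}}|m|^2dx+\overline{H}^2+\gamma\,\mathcal{Q}(u,m,\overline{H}),$$ $$\mathcal{Q}(u,m,\overline{H})=\int_{\mathbb{T}}|e^{H(x,u_x)-\overline{H}}-m|^2dx+\Big|\int_{\mathbb{T}}u\,dx\Big|^2+\Big|\int_{\mathbb{T}}m\,dx-1\Big|^2+\int_{\mathbb{T}}|m(u_{xx}+b_x(x))+m_x(u_x+b(x))|^2dx.$$ *)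

theory Defs
  imports "HOL-Analysis.Analysis"
begin

text \<open>
  Functions on the torus [0,1) are represented by 1-periodic functions on the reals, and integrals
  over the torus by integrals over the unit interval.  All spatial derivatives are classical
  ones (\<^const>\<open>deriv\<close>), since every function they are applied to is smooth.
\<close>

definition smooth_torus :: "(real \<Rightarrow> real) \<Rightarrow> bool" where
  "smooth_torus f \<longleftrightarrow>
     (\<forall>x. f (x + 1) = f x) \<and> (\<forall>k x. (deriv ^^ k) f differentiable (at x))"

abbreviation torus_integral :: "(real \<Rightarrow> real) \<Rightarrow> real" where
  "torus_integral f \<equiv> integral {0..1} f"

definition hamiltonian :: "(real \<Rightarrow> real) \<Rightarrow> (real \<Rightarrow> real) \<Rightarrow> real \<Rightarrow> real \<Rightarrow> real" where
  "hamiltonian V b x p = V x + p\<^sup>2 / 2 + b x * p"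

text \<open>
  Positivity of the density m is implicit in the term ln m of the first equation; it must be explicit
  here because \<^const>\<open>ln\<close> is a total function.
\<close>

definition mfg_solution ::
  "(real \<Rightarrow> real) \<Rightarrow> (real \<Rightarrow> real) \<Rightarrow> (real \<Rightarrow> real) \<Rightarrow> (real \<Rightarrow> real) \<Rightarrow> real \<Rightarrow> bool" where
  "mfg_solution V b u m Hbar \<longleftrightarrow>
     smooth_torus u \<and> smooth_torus m \<and> (\<forall>x. m x > 0) \<and>
     (\<forall>x. (deriv u x)\<^sup>2 / 2 + V x + b x * deriv u x = ln (m x) + Hbar) \<and>
     (\<forall>x. - deriv (\<lambda>y. m y * (deriv u y + b y)) x = 0) \<and>
     torus_integral m = 1 \<and> torus_integral u = 0"

definition trig_polys :: "nat \<Rightarrow> (real \<Rightarrow> real) set" where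
  "trig_polys N =
     {\<phi>. \<exists>c \<alpha> \<beta>. \<forall>x. \<phi> x = c + (\<Sum>i=1..N. \<alpha> i * sin (2 * pi * real i * x))
                               + (\<Sum>i=1..N. \<beta> i * cos (2 * pi * real i * x))}"

definition residual_Q ::
  "(real \<Rightarrow> real) \<Rightarrow> (real \<Rightarrow> real) \<Rightarrow> (real \<Rightarrow> real) \<Rightarrow> (real \<Rightarrow> real) \<Rightarrow> real \<Rightarrow> real" where
  "residual_Q V b u m Hbar =
     torus_integral (\<lambda>x. \<bar>exp (hamiltonian V b x (deriv u x) - Hbar) - m x\<bar>\<^sup>2)
     + \<bar>torus_integral u\<bar>\<^sup>2
     + \<bar>torus_integral m - 1\<bar>\<^sup>2
     + torus_integral (\<lambda>x. \<bar>m x * (deriv (deriv u) x + deriv b x)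
                             + deriv m x * (deriv u x + b x)\<bar>\<^sup>2)"

definition objective_J ::
  "(real \<Rightarrow> real) \<Rightarrow> (real \<Rightarrow> real) \<Rightarrow> real \<Rightarrow> (real \<Rightarrow> real) \<Rightarrow> (real \<Rightarrow> real) \<Rightarrow> real \<Rightarrow> real" where
  "objective_J V b \<gamma> u m Hbar =
     torus_integral (\<lambda>x. \<bar>u x\<bar>\<^sup>2) + torus_integral (\<lambda>x. \<bar>m x\<bar>\<^sup>2) + Hbar\<^sup>2
     + \<gamma> * residual_Q V b u m Hbar"

definition is_minimizer ::
  "(real \<Rightarrow> real) \<Rightarrow> (real \<Rightarrow> real) \<Rightarrow> nat \<Rightarrow> real \<Rightarrow> (real \<Rightarrow> real) \<Rightarrow> (real \<Rightarrow> real) \<Rightarrow> real \<Rightarrow> bool" where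
  "is_minimizer V b N \<gamma> u m Hbar \<longleftrightarrow>
     u \<in> trig_polys N \<and> m \<in> trig_polys N \<and>
     (\<forall>u' \<in> trig_polys N. \<forall>m' \<in> trig_polys N. \<forall>Hbar'.
        objective_J V b \<gamma> u m Hbar \<le> objective_J V b \<gamma> u' m' Hbar')"

text \<open>
  The norms of L1 and H1 on the torus.  They are only used for smooth functions, whose weak
  derivative is the classical one.
\<close>

definition L1_norm_torus :: "(real \<Rightarrow> real) \<Rightarrow> real" where
  "L1_norm_torus f = torus_integral (\<lambda>x. \<bar>f x\<bar>)"

definition H1_norm_torus :: "(real \<Rightarrow> real) \<Rightarrow> real" where
  "H1_norm_torus f =
     sqrt (torus_integral (\<lambda>x. \<bar>f x\<bar>\<^sup>2) + torus_integral (\<lambda>x. \<bar>deriv f x\<bar>\<^sup>2))"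

end

theory Submission
  imports Defs
begin

text \<open>
  Since \<open>b\<close> has mean zero, the system is explicitly solvable. The flux \<open>m (u\<^sub>x + b)\<close> is a constant
  \<open>c\<close>; dividing by \<open>m\<close> and integrating over the torus gives \<open>c \<integral> 1/m = 0\<close>, so \<open>u\<^sub>x = - b\<close> and
  \<open>m = exp (V - b\<^sup>2/2 - Hbar)\<close> (\<open>mfg_solution_deriv\<close>, \<open>mfg_solution_hamiltonian\<close>). This makes the
  solution stable with explicit constants.

  Stability: for any \<open>(u, m, H)\<close> put \<open>w = u\<^sub>x + b\<close>, which has mean zero, and
  \<open>E = exp (H(x,u\<^sub>x) - H) = s ms exp (w\<^sup>2/2)\<close> with \<open>s = exp (Hs - H)\<close>. If the residual is at most
  \<open>\<epsilon>\<close>, then \<open>m w\<close> is within \<open>sqrt \<epsilon>\<close> of a constant \<open>c\<close>, uniformly, and \<open>m\<close> is within \<open>sqrt \<epsilon>\<close> of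
  \<open>E\<close> in the square mean. Hence \<open>E w\<^sup>2 = w (m w) + (E - m) w\<^sup>2\<close> is \<open>c w\<close>, which integrates to zero,
  plus errors that Young's inequality absorbs into \<open>E w\<^sup>2\<close>, because \<open>E\<close> dominates a positive multiple of
  \<open>1 + w\<^sup>2/2\<close>. So \<open>\<integral> E w\<^sup>2 = O(\<epsilon>)\<close> (\<open>velocity_estimate\<close>). This bounds \<open>w\<close>, the derivative of
  \<open>u - us\<close>, in the square mean, and also \<open>E - s ms\<close> in the mean; comparing total masses yields
  \<open>s \<rightarrow> 1\<close> and \<open>m \<rightarrow> ms\<close> (\<open>density_estimate\<close>).

  Consistency: trigonometric polynomials come close to \<open>us\<close> with two derivatives and to \<open>ms\<close> with one,
  so that the residual can be made arbitrarily small at \<open>H = Hs\<close> while the other terms of the objective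
  stay below a fixed bound \<open>C\<close> (\<open>residual_competitor\<close>).
  For \<open>\<gamma>\<^sub>i = i + 1\<close> the degree \<open>N\<^sub>i\<close> is chosen so large that a competitor has residual at most
  \<open>1/\<gamma>\<^sub>i\<close>. The objective at a minimizer is then at most \<open>C + 1\<close>, so its residual is at most
  \<open>(C + 1)/\<gamma>\<^sub>i\<close> and its \<open>H\<close> stays bounded, and stability applies with a lower bound for \<open>s ms\<close> that
  does not depend on \<open>i\<close>.
\<close>

section \<open>Trigonometric polynomials\<close>

definition trig_poly :: "(real \<Rightarrow> real) \<Rightarrow> bool" where
  "trig_poly f \<longleftrightarrow> (\<exists>N. f \<in> trig_polys N)"

lemma trig_polysI:
  assumes "\<And>x. f x = c + (\<Sum>i=1..N. \<alpha> i * sin (2 * pi * real i * x))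
                        + (\<Sum>i=1..N. \<beta> i * cos (2 * pi * real i * x))"
  shows "f \<in> trig_polys N"
  using assms unfolding trig_polys_def by blast

lemma trig_polys_mono:
  assumes "N \<le> M"
  shows "trig_polys N \<subseteq> trig_polys M"
proof
  fix f assume "f \<in> trig_polys N"
  then obtain c \<alpha> \<beta> where f: "\<And>x. f x = c + (\<Sum>i=1..N. \<alpha> i * sin (2 * pi * real i * x))
                                             + (\<Sum>i=1..N. \<beta> i * cos (2 * pi * real i * x))"
    unfolding trig_polys_def by blast
  have pad: "(\<Sum>i=1..N. a i * g i) = (\<Sum>i=1..M. (if i \<le> N then a i else 0) * g i)"
    for a g :: "nat \<Rightarrow> real"
    by (rule sum.mono_neutral_cong_left) (use assms in auto)
  show "f \<in> trig_polys M"
    by (rule trig_polysI[where c = c and \<alpha> = "\<lambda>i. if i \<le> N then \<alpha> i else 0"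
          and \<beta> = "\<lambda>i. if i \<le> N then \<beta> i else 0"]) (simp only: f pad)
qed

lemma trig_poly_const: "trig_poly (\<lambda>x. c)"
  unfolding trig_poly_def
  by (intro exI[of _ 0] trig_polysI[where c = c and \<alpha> = "\<lambda>_. 0" and \<beta> = "\<lambda>_. 0"]) simp

lemma trig_poly_sin: "trig_poly (\<lambda>x. c * sin (2 * pi * real k * x))"
proof (cases "k = 0")
  case True
  then show ?thesis using trig_poly_const[of 0] by simp
next
  case False
  then show ?thesis unfolding trig_poly_def
    by (intro exI[of _ k] trig_polysI[where c = 0 and \<alpha> = "\<lambda>i. if i = k then c else 0" and \<beta> = "\<lambda>_. 0"])
       (auto simp: if_distrib[of "\<lambda>u. u * _"] cong: if_cong)
qed

lemma trig_poly_cos: "trig_poly (\<lambda>x. c * cos (2 * pi * real k * x))"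
proof (cases "k = 0")
  case True
  then show ?thesis using trig_poly_const[of c] by simp
next
  case False
  then show ?thesis unfolding trig_poly_def
    by (intro exI[of _ k] trig_polysI[where c = 0 and \<beta> = "\<lambda>i. if i = k then c else 0" and \<alpha> = "\<lambda>_. 0"])
       (auto simp: if_distrib[of "\<lambda>u. u * _"] cong: if_cong)
qed

lemma trig_poly_add:
  assumes "trig_poly f" "trig_poly g"
  shows "trig_poly (\<lambda>x. f x + g x)"
proof -
  obtain N where N: "f \<in> trig_polys N" "g \<in> trig_polys N"
    using assms trig_polys_mono unfolding trig_poly_def by (meson max.cobounded1 max.cobounded2 subsetD)
  then obtain c \<alpha> \<beta> c' \<alpha>' \<beta>'
    where "\<And>x. f x = c + (\<Sum>i=1..N. \<alpha> i * sin (2 * pi * real i * x))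
                       + (\<Sum>i=1..N. \<beta> i * cos (2 * pi * real i * x))"
      and "\<And>x. g x = c' + (\<Sum>i=1..N. \<alpha>' i * sin (2 * pi * real i * x))
                       + (\<Sum>i=1..N. \<beta>' i * cos (2 * pi * real i * x))"
    unfolding trig_polys_def by blast
  then show ?thesis unfolding trig_poly_def
    by (intro exI[of _ N] trig_polysI[where c = "c + c'" and \<alpha> = "\<lambda>i. \<alpha> i + \<alpha>' i" and \<beta> = "\<lambda>i. \<beta> i + \<beta>' i"])
       (simp add: distrib_right sum.distrib)
qed

text \<open>Every later closure property of trigonometric polynomials is linear in the function, so it
  suffices to check it on the basis.\<close>

lemma trig_poly_induct [consumes 1, case_names const sin cos add]:
  assumes f: "trig_poly f"
    and const: "\<And>c. P (\<lambda>x. c)"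
    and sin: "\<And>c k. P (\<lambda>x. c * sin (2 * pi * real k * x))"
    and cos: "\<And>c k. P (\<lambda>x. c * cos (2 * pi * real k * x))"
    and add: "\<And>f g. P f \<Longrightarrow> P g \<Longrightarrow> P (\<lambda>x. f x + g x)"
  shows "P f"
proof -
  obtain N c \<alpha> \<beta> where f: "f = (\<lambda>x. c + (\<Sum>i=1..N. \<alpha> i * sin (2 * pi * real i * x))
                                        + (\<Sum>i=1..N. \<beta> i * cos (2 * pi * real i * x)))"
    using f unfolding trig_poly_def trig_polys_def by blast
  have "P (\<lambda>x. \<Sum>i\<in>A. g i x)" if "finite A" "\<And>i. P (g i)" for A :: "nat set" and g
    using that by (induction A rule: finite_induct) (simp_all add: const add)
  then show ?thesis
    unfolding f by (intro add const) (simp_all add: sin cos)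
qed

lemma trig_poly_cmult: "trig_poly f \<Longrightarrow> trig_poly (\<lambda>x. a * f x)"
proof (induction rule: trig_poly_induct)
  case (const c) show ?case by (rule trig_poly_const)
next
  case (sin c k) show ?case using trig_poly_sin[of "a * c" k] by (simp add: mult.assoc)
next
  case (cos c k) show ?case using trig_poly_cos[of "a * c" k] by (simp add: mult.assoc)
next
  case (add f g) then show ?case using trig_poly_add by (simp add: distrib_left)
qed

lemma trig_poly_diff: "trig_poly f \<Longrightarrow> trig_poly g \<Longrightarrow> trig_poly (\<lambda>x. f x - g x)"
  using trig_poly_add[OF _ trig_poly_cmult[of g "-1"], of f] by simp

text \<open>The product-to-sum formulas produce differences of frequencies, hence the step from natural to
  integer frequencies.\<close>

lemma trig_poly_cos_int: "trig_poly (\<lambda>x. cos (2 * pi * of_int k * x))"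
proof (cases "k \<ge> 0")
  case True
  then show ?thesis using trig_poly_cos[of 1 "nat k"] by simp
next
  case False
  have "cos (2 * pi * of_int k * x) = cos (2 * pi * of_int (- k) * x)" for x :: real
    using cos_minus[of "2 * pi * of_int k * x"] by simp
  then show ?thesis using False trig_poly_cos[of 1 "nat (-k)"] by simp
qed

lemma trig_poly_sin_int: "trig_poly (\<lambda>x. sin (2 * pi * of_int k * x))"
proof (cases "k \<ge> 0")
  case True
  then show ?thesis using trig_poly_sin[of 1 "nat k"] by simp
next
  case False
  have "sin (2 * pi * of_int k * x) = - 1 * sin (2 * pi * of_int (- k) * x)" for x :: real
    using sin_minus[of "2 * pi * of_int k * x"] by simp
  then show ?thesis using False trig_poly_sin[of "-1" "nat (-k)"] by simp
qed

lemma trig_poly_mult: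
  assumes "trig_poly f" and g: "trig_poly g"
  shows "trig_poly (\<lambda>x. f x * g x)"
proof -
  have arg: "2 * pi * of_int (int k) * x + 2 * pi * of_int (int l) * x
               = 2 * pi * of_int (int k + int l) * x"
            "2 * pi * of_int (int k) * x - 2 * pi * of_int (int l) * x
               = 2 * pi * of_int (int k - int l) * x" for k l and x :: real
    by (simp_all add: algebra_simps)
  have ss: "trig_poly (\<lambda>x. sin (2*pi*real k*x) * sin (2*pi*real l*x))"
   and sc: "trig_poly (\<lambda>x. sin (2*pi*real k*x) * cos (2*pi*real l*x))"
   and cs: "trig_poly (\<lambda>x. cos (2*pi*real k*x) * sin (2*pi*real l*x))"
   and cc: "trig_poly (\<lambda>x. cos (2*pi*real k*x) * cos (2*pi*real l*x))" for k l
    using trig_poly_cmult[OF trig_poly_diff[OF trig_poly_cos_int trig_poly_cos_int], of "1/2" "int k - int l" "int k + int l"]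
      trig_poly_cmult[OF trig_poly_add[OF trig_poly_sin_int trig_poly_sin_int], of "1/2" "int k + int l" "int k - int l"]
      trig_poly_cmult[OF trig_poly_diff[OF trig_poly_sin_int trig_poly_sin_int], of "1/2" "int k + int l" "int k - int l"]
      trig_poly_cmult[OF trig_poly_add[OF trig_poly_cos_int trig_poly_cos_int], of "1/2" "int k - int l" "int k + int l"]
    unfolding sin_times_sin sin_times_cos cos_times_sin cos_times_cos
    by (simp_all only: arg[simplified of_int_of_nat_eq] of_int_of_nat_eq divide_inverse mult_1_left
        mult.commute[of "inverse 2"])
  have sg: "trig_poly (\<lambda>x. sin (2*pi*real k*x) * g x)" for k
    using g
  proof (induction rule: trig_poly_induct)
    case (const c) show ?case using trig_poly_sin[of c k] by (simp add: mult.commute)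
  next
    case (sin c l) show ?case using trig_poly_cmult[OF ss[of k l], of c] by (simp add: mult_ac)
  next
    case (cos c l) show ?case using trig_poly_cmult[OF sc[of k l], of c] by (simp add: mult_ac)
  next
    case (add f g) then show ?case using trig_poly_add by (simp add: distrib_left)
  qed
  have cg: "trig_poly (\<lambda>x. cos (2*pi*real k*x) * g x)" for k
    using g
  proof (induction rule: trig_poly_induct)
    case (const c) show ?case using trig_poly_cos[of c k] by (simp add: mult.commute)
  next
    case (sin c l) show ?case using trig_poly_cmult[OF cs[of k l], of c] by (simp add: mult_ac)
  next
    case (cos c l) show ?case using trig_poly_cmult[OF cc[of k l], of c] by (simp add: mult_ac)
  next
    case (add f g) then show ?case using trig_poly_add by (simp add: distrib_left)
  qed
  show ?thesis using assms(1)
  proof (induction rule: trig_poly_induct)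
    case (const c) show ?case using trig_poly_cmult[OF g] .
  next
    case (sin c k) show ?case using trig_poly_cmult[OF sg, of c k] by (simp add: mult.assoc)
  next
    case (cos c k) show ?case using trig_poly_cmult[OF cg, of c k] by (simp add: mult.assoc)
  next
    case (add f g) then show ?case using trig_poly_add by (simp add: distrib_right)
  qed
qed

lemma trig_poly_periodic: "trig_poly f \<Longrightarrow> f (x + 1) = f x"
proof (induction rule: trig_poly_induct)
  case (sin c k)
  have "sin (2 * pi * real k * x + 2 * pi * real k) = sin (2 * pi * real k * x)"
    using sin.plus_of_nat[of "2 * pi * real k * x" k] by (simp add: mult_ac)
  then show ?case by (simp add: distrib_left)
next
  case (cos c k)
  have "cos (2 * pi * real k * x + 2 * pi * real k) = cos (2 * pi * real k * x)"
    using cos.plus_of_nat[of "2 * pi * real k * x" k] by (simp add: mult_ac)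
  then show ?case by (simp add: distrib_left)
qed auto

lemma trig_poly_derivative:
  "trig_poly f \<Longrightarrow> \<exists>g. trig_poly g \<and> (\<forall>x. (f has_real_derivative g x) (at x))"
proof (induction rule: trig_poly_induct)
  case (const c) show ?case using trig_poly_const[of 0] by (auto intro!: exI[of _ "\<lambda>x. 0"])
next
  case (sin c k)
  show ?case using trig_poly_cos[of "c * (2 * pi * real k)" k]
    by (intro exI[of _ "\<lambda>x. c * (2 * pi * real k) * cos (2 * pi * real k * x)"])
       (auto intro!: derivative_eq_intros)
next
  case (cos c k)
  show ?case using trig_poly_sin[of "- c * (2 * pi * real k)" k]
    by (intro exI[of _ "\<lambda>x. - c * (2 * pi * real k) * sin (2 * pi * real k * x)"])
       (auto intro!: derivative_eq_intros)
next
  case (add f g)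
  then show ?case by (blast intro: trig_poly_add DERIV_add)
qed

lemma trig_poly_deriv:
  assumes "trig_poly f"
  shows "trig_poly (deriv f)" and "(f has_real_derivative deriv f x) (at x)"
proof -
  obtain g where g: "trig_poly g" "\<And>x. (f has_real_derivative g x) (at x)"
    using trig_poly_derivative[OF assms] by blast
  then have "deriv f = g" by (auto simp: DERIV_imp_deriv)
  then show "trig_poly (deriv f)" "(f has_real_derivative deriv f x) (at x)" using g by auto
qed

lemma trig_poly_continuous: "trig_poly f \<Longrightarrow> continuous_on S f"
  using trig_poly_deriv(2) by (meson DERIV_isCont continuous_at_imp_continuous_on)

text \<open>A periodic antiderivative exists only after removing the mean, which is the constant
  \<open>c\<close> below.\<close>

lemma trig_poly_antiderivative:
  "trig_poly f \<Longrightarrow> \<exists>F c. trig_poly F \<and> (\<forall>x. (F has_real_derivative f x - c) (at x))"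
proof (induction rule: trig_poly_induct)
  case (const c) show ?case using trig_poly_const[of 0] by (intro exI[of _ "\<lambda>x. 0"] exI[of _ c]) auto
next
  case (sin c k)
  show ?case
  proof (cases "k = 0")
    case True
    then show ?thesis using trig_poly_const[of 0] by (intro exI[of _ "\<lambda>x. 0"] exI[of _ 0]) auto
  next
    case False
    then show ?thesis using trig_poly_cos[of "- c / (2 * pi * real k)" k]
      by (intro exI[of _ "\<lambda>x. - c / (2 * pi * real k) * cos (2 * pi * real k * x)"] exI[of _ 0])
         (auto intro!: derivative_eq_intros)
  qed
next
  case (cos c k)
  show ?case
  proof (cases "k = 0")
    case True
    then show ?thesis using trig_poly_const[of 0] by (intro exI[of _ "\<lambda>x. 0"] exI[of _ c]) auto
  next
    case False
    then show ?thesis using trig_poly_sin[of "c / (2 * pi * real k)" k]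
      by (intro exI[of _ "\<lambda>x. c / (2 * pi * real k) * sin (2 * pi * real k * x)"] exI[of _ 0])
         (auto intro!: derivative_eq_intros)
  qed
next
  case (add f g)
  then obtain F c G d where "trig_poly F" "\<And>x. (F has_real_derivative f x - c) (at x)"
     "trig_poly G" "\<And>x. (G has_real_derivative g x - d) (at x)" by blast
  then show ?case
    by (intro exI[of _ "\<lambda>x. F x + G x"] exI[of _ "c + d"])
       (auto intro!: trig_poly_add derivative_eq_intros)
qed

section \<open>Approximation by trigonometric polynomials\<close>

lemma periodic_frac:
  fixes f :: "real \<Rightarrow> 'a"
  assumes "\<And>x. f (x + 1) = f x"
  shows "f (frac x) = f x"
proof -
  interpret periodic_fun_simple' f by unfold_locales (rule assms)
  show ?thesis using minus_of_int[of x "\<lfloor>x\<rfloor>"] by (simp add: frac_def)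
qed

lemma polynomial_on_circle_trig_poly:
  fixes g :: "complex \<Rightarrow> real"
  assumes "real_polynomial_function g"
  shows "trig_poly (\<lambda>x. g (cis (2 * pi * x)))"
  using assms
proof induction
  case (linear g)
  interpret bounded_linear g by fact
  have "g (cis t) = g 1 * cos t + g \<i> * sin t" for t
  proof -
    have "cis t = cos t *\<^sub>R 1 + sin t *\<^sub>R \<i>" by (simp add: complex_eq_iff)
    then show ?thesis by (simp only: add scaleR) simp
  qed
  then show ?case using trig_poly_add[OF trig_poly_cos trig_poly_sin, of "g 1" 1 "g \<i>" 1] by simp
qed (auto intro: trig_poly_const trig_poly_add trig_poly_mult)

text \<open>A continuous periodic function is a continuous function on the unit circle, where
  Stone--Weierstrass gives polynomials in the coordinates. Continuity of the induced function on the
  circle, including at the point 1 where the argument jumps, is read off from the correspondence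
  between loops and maps of the circle.\<close>

theorem trig_poly_dense:
  fixes f :: "real \<Rightarrow> real"
  assumes cont: "continuous_on UNIV f" and per: "\<And>x. f (x + 1) = f x" and "e > 0"
  obtains p where "trig_poly p" "\<And>x. \<bar>f x - p x\<bar> < e"
proof -
  let ?F = "f \<circ> (\<lambda>z. Arg2pi z / (2 * pi))"
  have "homotopic_loops UNIV f f"
    using per[of 0] cont unfolding homotopic_loops_refl
    by (auto simp: path_def pathfinish_def pathstart_def intro: continuous_on_subset)
  then have "continuous_on (sphere 0 1) ?F"
    using homotopic_with_imp_continuous[OF homotopic_loops_imp_homotopic_circlemaps] by blast
  then obtain g where g: "real_polynomial_function g" "\<And>z. z \<in> sphere 0 1 \<Longrightarrow> \<bar>?F z - g z\<bar> < e"
    using Stone_Weierstrass_real_polynomial_function[of "sphere 0 (1::real) :: complex set" ?F e] \<open>e > 0\<close>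
    by auto
  have p: "trig_poly (\<lambda>x. g (cis (2 * pi * x)))" by (rule polynomial_on_circle_trig_poly[OF g(1)])
  have "\<bar>f x - g (cis (2 * pi * x))\<bar> < e" for x
  proof -
    have "Arg2pi (cis (2 * pi * frac x)) = 2 * pi * frac x"
      by (rule Arg2pi_unique[of 1]) (auto simp: cis_conv_exp frac_lt_1)
    then have "\<bar>f (frac x) - g (cis (2 * pi * frac x))\<bar> < e"
      using g(2)[of "cis (2 * pi * frac x)"] by simp
    then show ?thesis
      by (simp only: periodic_frac[of f, OF per]
          periodic_frac[of "\<lambda>x. g (cis (2 * pi * x))", OF trig_poly_periodic[OF p]])
  qed
  then show ?thesis by (rule that[OF p])
qed

text \<open>The mean removed when integrating \<open>q\<close> is itself of the size of the error: the difference of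
  \<open>F\<close> and the antiderivative is periodic, so its derivative has a zero by Rolle's theorem.\<close>

lemma trig_poly_approx_antiderivative:
  fixes F :: "real \<Rightarrow> real"
  assumes F: "\<And>x. (F has_real_derivative F' x) (at x)" and per: "\<And>x. F (x + 1) = F x"
    and q: "trig_poly q" "\<And>x. \<bar>F' x - q x\<bar> \<le> e"
  shows "\<exists>P c. trig_poly P \<and> (\<forall>x. (P has_real_derivative q x - c) (at x)) \<and>
    (\<forall>x. \<bar>F' x - (q x - c)\<bar> \<le> 2 * e) \<and> (\<forall>x. \<bar>F x - P x\<bar> \<le> 2 * e)"
proof -
  obtain Q c where Q: "trig_poly Q" "\<And>x. (Q has_real_derivative q x - c) (at x)"
    using trig_poly_antiderivative[OF q(1)] by blast
  define P where "P = (\<lambda>x. F 0 - Q 0 + Q x)"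
  have P: "trig_poly P" "(P has_real_derivative q x - c) (at x)" for x
    unfolding P_def using Q trig_poly_const trig_poly_add by (auto intro!: derivative_eq_intros)
  have D: "((\<lambda>x. F x - P x) has_real_derivative F' x - (q x - c)) (at x)" for x
    using F P(2) by (auto intro!: derivative_eq_intros)
  have "\<exists>z>0. z < 1 \<and> F 1 - P 1 - (F 0 - P 0) = (1 - 0) * (F' z - (q z - c))"
    using MVT2[of 0 1 "\<lambda>x. F x - P x", OF _ D] by auto
  then obtain z where "F' z - (q z - c) = 0"
    using per[of 0] trig_poly_periodic[OF P(1), of 0] by auto
  then have "\<bar>c\<bar> \<le> e" using q(2)[of z] by simp
  then have bd: "\<bar>F' x - (q x - c)\<bar> \<le> 2 * e" for x
    using q(2)[of x] by linarith
  have small: "\<bar>F x - P x\<bar> \<le> 2 * e" if "0 \<le> x" "x < 1" for x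
  proof (cases "x = 0")
    case True
    then show ?thesis using bd[of 0] by (simp add: P_def)
  next
    case False
    with that have "0 < x" by simp
    then obtain z where z: "F x - P x - (F 0 - P 0) = (x - 0) * (F' z - (q z - c))"
      using MVT2[of 0 x "\<lambda>x. F x - P x", OF _ D] by auto
    then have "\<bar>F x - P x\<bar> = x * \<bar>F' z - (q z - c)\<bar>"
      using that by (simp add: P_def abs_mult)
    also have "\<dots> \<le> 1 * (2 * e)" using that bd[of z] by (intro mult_mono) auto
    finally show ?thesis by simp
  qed
  have "\<bar>F x - P x\<bar> \<le> 2 * e" for x
    using small[of "frac x"]
    by (simp add: frac_lt_1 periodic_frac[of F, OF per] periodic_frac[of P, OF trig_poly_periodic[OF P(1)]])
  with P bd show ?thesis by (intro exI[of _ P] exI[of _ c]) simp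
qed

section \<open>Smooth functions and integrals over the torus\<close>

lemma smooth_torus_DERIV:
  assumes "smooth_torus f"
  shows "(f has_real_derivative deriv f x) (at x)"
proof -
  have "(deriv ^^ 0) f differentiable (at x)" using assms unfolding smooth_torus_def by blast
  then show ?thesis by (simp add: DERIV_deriv_iff_real_differentiable)
qed

lemma smooth_torus_deriv:
  assumes "smooth_torus f"
  shows "smooth_torus (deriv f)"
  unfolding smooth_torus_def
proof (intro conjI allI)
  fix k x
  have "(\<lambda>y. f (y + 1)) = f" using assms by (auto simp: smooth_torus_def)
  then have "(f has_real_derivative deriv f (x + 1)) (at x)"
    using smooth_torus_DERIV[OF assms, of "x + 1"] by (simp add: DERIV_shift)
  then show "deriv f (x + 1) = deriv f x" by (simp add: DERIV_imp_deriv)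
  have "(deriv ^^ Suc k) f differentiable (at x)" using assms unfolding smooth_torus_def by blast
  then show "(deriv ^^ k) (deriv f) differentiable (at x)" by (simp add: funpow_swap1)
qed

lemma smooth_torus_continuous: "smooth_torus f \<Longrightarrow> continuous_on S f"
  using smooth_torus_DERIV by (meson DERIV_isCont continuous_at_imp_continuous_on)

lemma smooth_torus_periodic: "smooth_torus f \<Longrightarrow> f (x + 1) = f x"
  by (simp add: smooth_torus_def)

lemma torus_integral_nonneg:
  fixes f :: "real \<Rightarrow> real"
  assumes "\<And>x. f x \<ge> 0"
  shows "torus_integral f \<ge> 0"
  using assms integral_nonneg[of f "{0..1}"] not_integrable_integral[of f "{0..1}"] by fastforce

lemma square_torus_integral_abs_le:
  fixes f :: "real \<Rightarrow> real"
  assumes f: "continuous_on {0..1} f"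
  shows "(torus_integral (\<lambda>x. \<bar>f x\<bar>))\<^sup>2 \<le> torus_integral (\<lambda>x. (f x)\<^sup>2)"
proof -
  define I where "I = torus_integral (\<lambda>x. \<bar>f x\<bar>)"
  have "torus_integral (\<lambda>x. 2 * I * \<bar>f x\<bar> - I\<^sup>2) \<le> torus_integral (\<lambda>x. (f x)\<^sup>2)"
  proof (rule integral_le)
    show "2 * I * \<bar>f x\<bar> - I\<^sup>2 \<le> (f x)\<^sup>2" for x
      using zero_le_power2[of "\<bar>f x\<bar> - I"] by (simp add: power2_diff algebra_simps)
  qed (intro integrable_continuous_real continuous_intros f)+
  also have "torus_integral (\<lambda>x. 2 * I * \<bar>f x\<bar> - I\<^sup>2) = 2 * I * I - I\<^sup>2"
    unfolding I_def
    by (subst integral_diff) (auto intro!: integrable_continuous_real continuous_intros f)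
  finally show ?thesis unfolding I_def by (simp add: power2_eq_square)
qed

lemma abs_torus_integral_le_sqrt:
  fixes f :: "real \<Rightarrow> real"
  assumes f: "continuous_on {0..1} f" and le: "torus_integral (\<lambda>x. (f x)\<^sup>2) \<le> e"
  shows "torus_integral (\<lambda>x. \<bar>f x\<bar>) \<le> sqrt e" "\<bar>torus_integral f\<bar> \<le> sqrt e"
proof -
  show 1: "torus_integral (\<lambda>x. \<bar>f x\<bar>) \<le> sqrt e"
    using order_trans[OF square_torus_integral_abs_le[OF f] le] by (rule real_le_rsqrt)
  have "\<bar>torus_integral f\<bar> \<le> torus_integral (\<lambda>x. \<bar>f x\<bar>)"
    using Henstock_Kurzweil_Integration.integral_norm_bound_integral[of f "{0..1}" "\<lambda>x. \<bar>f x\<bar>"] f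
    by (auto intro!: integrable_continuous_real continuous_intros)
  with 1 show "\<bar>torus_integral f\<bar> \<le> sqrt e" by linarith
qed

lemma oscillation_le:
  fixes f f' :: "real \<Rightarrow> real"
  assumes f: "\<And>x. (f has_real_derivative f' x) (at x)" and f': "continuous_on {0..1} f'"
    and "x \<in> {0..1}" "y \<in> {0..1}"
  shows "(f x - f y)\<^sup>2 \<le> torus_integral (\<lambda>x. (f' x)\<^sup>2)"
proof -
  have *: "\<bar>f b - f a\<bar> \<le> torus_integral (\<lambda>x. \<bar>f' x\<bar>)" if "0 \<le> a" "a \<le> b" "b \<le> 1" for a b
  proof -
    have sub: "{a..b} \<subseteq> {0..1}" using that by auto
    have "(f' has_integral f b - f a) {a..b}"
      using that f by (intro fundamental_theorem_of_calculus)
        (auto simp: has_real_derivative_iff_has_vector_derivative[symmetric] intro: DERIV_subset)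
    then have "\<bar>f b - f a\<bar> = \<bar>integral {a..b} f'\<bar>" by (simp add: integral_unique)
    also have "\<dots> \<le> integral {a..b} (\<lambda>x. \<bar>f' x\<bar>)"
      using Henstock_Kurzweil_Integration.integral_norm_bound_integral[of f' "{a..b}" "\<lambda>x. \<bar>f' x\<bar>"] continuous_on_subset[OF f' sub]
      by (auto intro!: integrable_continuous_real continuous_intros)
    also have "\<dots> \<le> torus_integral (\<lambda>x. \<bar>f' x\<bar>)"
      using sub continuous_on_subset[OF f' sub] f'
      by (intro integral_subset_le integrable_continuous_real continuous_intros) auto
    finally show ?thesis .
  qed
  have "\<bar>f x - f y\<bar> \<le> torus_integral (\<lambda>x. \<bar>f' x\<bar>)"
    using *[of x y] *[of y x] assms(3,4) by (cases "x \<le> y") (auto simp: abs_minus_commute)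
  then have "\<bar>f x - f y\<bar>\<^sup>2 \<le> (torus_integral (\<lambda>x. \<bar>f' x\<bar>))\<^sup>2"
    by (intro power_mono) auto
  then show ?thesis using square_torus_integral_abs_le[OF f'] by simp
qed

text \<open>Poincare's inequality keeps the mean on the right-hand side because the mean of an
  approximate solution is controlled only through the residual.\<close>

lemma poincare_torus:
  fixes v v' :: "real \<Rightarrow> real"
  assumes v: "\<And>x. (v has_real_derivative v' x) (at x)" and v': "continuous_on {0..1} v'"
  shows "torus_integral (\<lambda>x. (v x)\<^sup>2)
           \<le> 2 * (torus_integral v)\<^sup>2 + 2 * torus_integral (\<lambda>x. (v' x)\<^sup>2)"
proof -
  have cont: "continuous_on {0..1} v" using v by (meson DERIV_isCont continuous_at_imp_continuous_on)
  define A where "A = torus_integral v"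
  define W where "W = torus_integral (\<lambda>x. (v' x)\<^sup>2)"
  have pt: "(v x)\<^sup>2 \<le> 2 * A\<^sup>2 + 2 * W" if x: "x \<in> {0..1}" for x
  proof -
    have "torus_integral (\<lambda>y. (v x - v y)\<^sup>2) \<le> torus_integral (\<lambda>y. W)"
      using oscillation_le[OF v v' x] cont unfolding W_def
      by (intro integral_le integrable_continuous_real continuous_intros) auto
    then have "\<bar>torus_integral (\<lambda>y. v x - v y)\<bar> \<le> sqrt W"
      by (intro abs_torus_integral_le_sqrt(2) continuous_intros cont) simp
    moreover have "torus_integral (\<lambda>y. v x - v y) = v x - A"
      unfolding A_def by (subst integral_diff) (auto intro!: integrable_continuous_real cont)
    ultimately have "(v x - A)\<^sup>2 \<le> W"
      using sqrt_le_D[of "(v x - A)\<^sup>2" "W"] by (metis real_sqrt_abs real_sqrt_le_iff)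
    moreover have "(v x)\<^sup>2 \<le> 2 * A\<^sup>2 + 2 * (v x - A)\<^sup>2"
      using zero_le_power2[of "v x - 2 * A"] by (simp add: power2_eq_square algebra_simps)
    ultimately show ?thesis by linarith
  qed
  have "torus_integral (\<lambda>x. (v x)\<^sup>2) \<le> torus_integral (\<lambda>x. 2 * A\<^sup>2 + 2 * W)"
    using pt cont by (intro integral_le integrable_continuous_real continuous_intros) auto
  then show ?thesis by (simp add: A_def W_def)
qed

section \<open>The solution of the mean field game system\<close>

text \<open>The flux is a constant \<open>c\<close>, so \<open>c (us\<^sub>x + b) = c\<^sup>2 / ms\<close>. The left-hand side has mean zero
  and the right-hand side is nonnegative, which forces \<open>c = 0\<close>.\<close>

lemma mfg_solution_deriv:
  assumes b: "smooth_torus b" "torus_integral b = 0" and sol: "mfg_solution V b us ms Hs"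
  shows "deriv us x = - b x"
proof -
  have sm: "smooth_torus us" "smooth_torus ms" "smooth_torus (deriv us)" and pos: "\<And>x. ms x > 0"
    and flux: "\<And>x. deriv (\<lambda>y. ms y * (deriv us y + b y)) x = 0"
    using sol smooth_torus_deriv unfolding mfg_solution_def by auto
  let ?F = "\<lambda>y. ms y * (deriv us y + b y)"
  have "(?F has_real_derivative deriv ?F x) (at x)" for x
  proof -
    have "(?F has_real_derivative
            ms x * (deriv (deriv us) x + deriv b x) + deriv ms x * (deriv us x + b x)) (at x)"
      using smooth_torus_DERIV[OF sm(2), of x] smooth_torus_DERIV[OF sm(3), of x]
        smooth_torus_DERIV[OF b(1), of x]
      by (auto intro!: derivative_eq_intros)
    then show ?thesis by (simp add: DERIV_imp_deriv)
  qed
  then have "?F x = ?F 0" for x using DERIV_isconst_all[of ?F x 0] flux by auto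
  moreover define c where "c = ?F 0"
  ultimately have F: "deriv us x + b x = c / ms x" for x
    using pos[of x] by (simp add: field_simps)
  have "(deriv us has_integral us 1 - us 0) {0..1}"
    using smooth_torus_DERIV[OF sm(1)] by (intro fundamental_theorem_of_calculus)
      (auto simp: has_real_derivative_iff_has_vector_derivative[symmetric] intro: DERIV_subset)
  then have "torus_integral (deriv us) = 0"
    using smooth_torus_periodic[OF sm(1), of 0] by (simp add: integral_unique)
  then have "torus_integral (\<lambda>x. deriv us x + b x) = 0"
    using b by (subst integral_add) (auto intro!: integrable_continuous_real smooth_torus_continuous sm)
  then have "torus_integral (\<lambda>x. c * (c / ms x)) = 0"
    unfolding F by (simp del: times_divide_eq_right)
  moreover have "continuous_on {0..1} (\<lambda>x. c * (c / ms x))"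
    using pos smooth_torus_continuous[OF sm(2)] by (intro continuous_intros) (auto simp: less_imp_neq[symmetric])
  moreover have "c * (c / ms x) \<ge> 0" for x
    using pos[of x] by (simp add: field_simps power2_eq_square[symmetric])
  ultimately have "c * (c / ms 0) = 0"
    using integral_eq_0_iff[of 0 1 "\<lambda>x. c * (c / ms x)"] by auto
  then show ?thesis using F[of x] pos[of 0] by auto
qed

text \<open>Completing the square in \<open>p\<close> around the optimal velocity \<open>us\<^sub>x = - b\<close>: the exponential of the
  Hamiltonian is the exact density up to a constant factor and a Gaussian weight in the excess velocity.\<close>

lemma mfg_solution_hamiltonian:
  assumes b: "smooth_torus b" "torus_integral b = 0" and sol: "mfg_solution V b us ms Hs"
  shows "exp (hamiltonian V b x p - H) = exp (Hs - H) * ms x * exp ((p + b x)\<^sup>2 / 2)"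
proof -
  have pos: "ms x > 0" and "(deriv us x)\<^sup>2 / 2 + V x + b x * deriv us x = ln (ms x) + Hs"
    using sol by (auto simp: mfg_solution_def)
  then have eq: "hamiltonian V b x p - H = (Hs - H) + ln (ms x) + (p + b x)\<^sup>2 / 2"
    unfolding mfg_solution_deriv[OF assms] hamiltonian_def
    by (simp add: power2_eq_square field_simps)
  show ?thesis unfolding eq exp_add using pos by simp
qed

section \<open>Stability\<close>

lemma exp_minus_one_le: "exp t - 1 \<le> t * exp t" for t :: real
proof -
  have "(1 + - t) * exp t \<le> exp (- t) * exp t"
    using exp_ge_add_one_self[of "- t"] by (intro mult_right_mono) auto
  then show ?thesis by (simp add: exp_minus algebra_simps)
qed

lemma young_le:
  fixes a b k :: real
  assumes "k > 0"
  shows "a * b \<le> a\<^sup>2 / k + k / 4 * b\<^sup>2"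
proof -
  have "0 \<le> k * (a / k - b / 2)\<^sup>2" using assms by simp
  also have "\<dots> = a\<^sup>2 / k + k / 4 * b\<^sup>2 - a * b" using assms
    by (simp add: power2_eq_square field_simps)
  finally show ?thesis by simp
qed

text \<open>This is the core of the stability argument. As \<open>m\<close> may change sign, the weight in the
  energy is \<open>E\<close> rather than \<open>m\<close>. The growth \<open>E \<ge> \<kappa> (1 + w\<^sup>2/2)\<close> provides both \<open>w\<^sup>2\<close>, which absorbs the
  oscillation of the flux, and \<open>w\<^sup>4\<close>, which absorbs the product of \<open>E - m\<close> and \<open>w\<^sup>2\<close>.\<close>

lemma velocity_estimate:
  fixes m w m' w' g :: "real \<Rightarrow> real" and \<kappa> \<epsilon> :: real
  defines "E \<equiv> \<lambda>x. g x * exp ((w x)\<^sup>2 / 2)"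
  assumes m: "\<And>x. (m has_real_derivative m' x) (at x)" and w: "\<And>x. (w has_real_derivative w' x) (at x)"
    and cont: "continuous_on {0..1} m'" "continuous_on {0..1} w'" "continuous_on {0..1} g"
    and "\<kappa> > 0" and \<kappa>: "\<And>x. x \<in> {0..1} \<Longrightarrow> \<kappa> \<le> g x"
    and mean: "torus_integral w = 0"
    and r1: "torus_integral (\<lambda>x. (E x - m x)\<^sup>2) \<le> \<epsilon>"
    and r2: "torus_integral (\<lambda>x. (m x * w' x + m' x * w x)\<^sup>2) \<le> \<epsilon>"
  shows "torus_integral (\<lambda>x. E x * (w x)\<^sup>2) \<le> 4 * \<epsilon> / \<kappa>"
    and "torus_integral (\<lambda>x. (w x)\<^sup>2) \<le> 4 * \<epsilon> / \<kappa>\<^sup>2"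
proof -
  have cm: "continuous_on {0..1} m" and cw: "continuous_on {0..1} w"
    using m w by (meson DERIV_isCont continuous_at_imp_continuous_on)+
  have cE: "continuous_on {0..1} E" unfolding E_def by (auto intro!: continuous_intros cw cont)
  note ci = integrable_continuous_real continuous_intros cm cw cE cont
  have E\<kappa>: "\<kappa> * (1 + (w x)\<^sup>2 / 2) \<le> E x" if "x \<in> {0..1}" for x
    unfolding E_def using \<kappa>[OF that] \<open>\<kappa> > 0\<close> exp_ge_add_one_self[of "(w x)\<^sup>2 / 2"]
    by (intro mult_mono) auto
  have D: "((\<lambda>x. m x * w x) has_real_derivative m x * w' x + m' x * w x) (at x)" for x
    using m[of x] w[of x] by (auto intro!: derivative_eq_intros)
  define c where "c = m 0 * w 0"
  have pt: "E x * (w x)\<^sup>2 \<le> 2 * (c * w x + \<epsilon> / \<kappa> + (E x - m x)\<^sup>2 / \<kappa>)" if x: "x \<in> {0..1}" for x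
  proof -
    \<comment> \<open>The deviation of the flux \<open>m w\<close> from the constant \<open>c\<close>.\<close>
    define \<rho> where "\<rho> = m x * w x - c"
    have "\<rho>\<^sup>2 \<le> torus_integral (\<lambda>x. (m x * w' x + m' x * w x)\<^sup>2)"
      unfolding \<rho>_def c_def by (rule oscillation_le[OF D _ x]) (auto intro!: ci)
    then have \<rho>: "\<rho>\<^sup>2 / \<kappa> \<le> \<epsilon> / \<kappa>" using r2 \<open>\<kappa> > 0\<close> by (intro divide_right_mono) auto
    have "E x * (w x)\<^sup>2 = c * w x + \<rho> * w x + (E x - m x) * (w x)\<^sup>2"
      by (simp add: \<rho>_def power2_eq_square algebra_simps)
    also have "\<dots> \<le> c * w x + (\<epsilon> / \<kappa> + \<kappa> / 4 * (w x)\<^sup>2) + ((E x - m x)\<^sup>2 / \<kappa> + \<kappa> / 4 * ((w x)\<^sup>2)\<^sup>2)"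
      using young_le[OF \<open>\<kappa> > 0\<close>, of \<rho> "w x"] young_le[OF \<open>\<kappa> > 0\<close>, of "E x - m x" "(w x)\<^sup>2"] \<rho>
      by linarith
    finally have "E x * (w x)\<^sup>2 \<le> c * w x + \<epsilon> / \<kappa> + (E x - m x)\<^sup>2 / \<kappa>
                    + \<kappa> * (1 / 4 + (w x)\<^sup>2 / 4) * (w x)\<^sup>2"
      by (simp add: power2_eq_square algebra_simps)
    moreover have "\<kappa> * (1 / 4 + (w x)\<^sup>2 / 4) * (w x)\<^sup>2 \<le> (E x / 2) * (w x)\<^sup>2"
      using E\<kappa>[OF x] \<open>\<kappa> > 0\<close> by (intro mult_right_mono) (auto simp: algebra_simps)
    ultimately show ?thesis by simp
  qed
  have "torus_integral (\<lambda>x. E x * (w x)\<^sup>2)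
          \<le> torus_integral (\<lambda>x. 2 * (c * w x + \<epsilon> / \<kappa> + (E x - m x)\<^sup>2 / \<kappa>))"
    using pt \<open>\<kappa> > 0\<close> by (intro integral_le ci) auto
  also have "\<dots> = 2 * (c * 0 + \<epsilon> / \<kappa> + torus_integral (\<lambda>x. (E x - m x)\<^sup>2) / \<kappa>)"
    using \<open>\<kappa> > 0\<close> mean by (simp add: integral_add ci)
  also have "\<dots> \<le> 2 * (\<epsilon> / \<kappa> + \<epsilon> / \<kappa>)"
    using divide_right_mono[OF r1 less_imp_le[OF \<open>\<kappa> > 0\<close>]]
    by (intro mult_left_mono add_mono) simp_all
  finally show Ew: "torus_integral (\<lambda>x. E x * (w x)\<^sup>2) \<le> 4 * \<epsilon> / \<kappa>" by simp
  have "\<kappa> \<le> E x" if "x \<in> {0..1}" for x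
  proof -
    have "\<kappa> * 1 \<le> \<kappa> * (1 + (w x)\<^sup>2 / 2)" using \<open>\<kappa> > 0\<close> by (intro mult_left_mono) auto
    then show ?thesis using E\<kappa>[OF that] by simp
  qed
  then have "torus_integral (\<lambda>x. \<kappa> * (w x)\<^sup>2) \<le> torus_integral (\<lambda>x. E x * (w x)\<^sup>2)"
    by (intro integral_le ci mult_right_mono) auto
  then have "\<kappa> * torus_integral (\<lambda>x. (w x)\<^sup>2) \<le> 4 * \<epsilon> / \<kappa>" using Ew by simp
  then show "torus_integral (\<lambda>x. (w x)\<^sup>2) \<le> 4 * \<epsilon> / \<kappa>\<^sup>2"
    using \<open>\<kappa> > 0\<close> by (simp add: field_simps power2_eq_square)
qed

text \<open>The inequality \<open>exp t - 1 \<le> t exp t\<close> at \<open>t = w\<^sup>2/2\<close> turns the weighted bound on \<open>w\<^sup>2\<close> into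
  closeness of \<open>E\<close> to \<open>s h\<close> in the mean. As \<open>h\<close> has mass 1 and the mass of \<open>E\<close> is nearly that of \<open>m\<close>,
  hence nearly 1, the factor \<open>s\<close> is nearly 1.\<close>

lemma density_estimate:
  fixes m w h :: "real \<Rightarrow> real" and s \<epsilon> \<delta> :: real
  defines "E \<equiv> \<lambda>x. s * h x * exp ((w x)\<^sup>2 / 2)"
  assumes cm: "continuous_on {0..1} m" and cw: "continuous_on {0..1} w" and ch: "continuous_on {0..1} h"
    and "s > 0" and h: "\<And>x. h x > 0" "torus_integral h = 1"
    and Ew: "torus_integral (\<lambda>x. E x * (w x)\<^sup>2) \<le> 2 * \<delta>"
    and r1: "torus_integral (\<lambda>x. (E x - m x)\<^sup>2) \<le> \<epsilon>"
    and mass: "(torus_integral m - 1)\<^sup>2 \<le> \<epsilon>"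
  shows "\<bar>s - 1\<bar> \<le> 2 * sqrt \<epsilon> + \<delta>"
    and "torus_integral (\<lambda>x. \<bar>m x - h x\<bar>) \<le> 3 * sqrt \<epsilon> + 2 * \<delta>"
proof -
  have cE: "continuous_on {0..1} E" unfolding E_def by (auto intro!: continuous_intros cw ch)
  note ci = integrable_continuous_real continuous_intros cm cw cE ch
  have lower: "s * h x \<le> E x" for x
    unfolding E_def using mult_left_mono[of 1 "exp ((w x)\<^sup>2 / 2)" "s * h x"] h(1)[of x] \<open>s > 0\<close> by simp
  have upper: "E x - s * h x \<le> E x * (w x)\<^sup>2 / 2" for x
  proof -
    have "(s * h x) * (exp ((w x)\<^sup>2 / 2) - 1) \<le> (s * h x) * ((w x)\<^sup>2 / 2 * exp ((w x)\<^sup>2 / 2))"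
      using h(1)[of x] \<open>s > 0\<close> by (intro mult_left_mono exp_minus_one_le) (auto intro: less_imp_le)
    then show ?thesis by (simp add: E_def algebra_simps)
  qed
  have intdiff: "torus_integral (\<lambda>x. E x - s * h x) = torus_integral E - s"
    using h(2) by (subst integral_diff) (auto intro!: ci)
  have "torus_integral (\<lambda>x. E x - s * h x) \<le> torus_integral (\<lambda>x. E x * (w x)\<^sup>2 / 2)"
    using upper by (intro integral_le ci) auto
  also have "\<dots> \<le> \<delta>" using Ew by simp
  finally have up: "torus_integral E - s \<le> \<delta>" using intdiff by simp
  have lo: "0 \<le> torus_integral E - s"
    using integral_nonneg[of "\<lambda>x. E x - s * h x" "{0..1}"] lower intdiff by (simp add: ci)
  have r1': "torus_integral (\<lambda>x. \<bar>E x - m x\<bar>) \<le> sqrt \<epsilon>" "\<bar>torus_integral (\<lambda>x. E x - m x)\<bar> \<le> sqrt \<epsilon>"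
    by (rule abs_torus_integral_le_sqrt[OF _ r1], intro ci)+
  moreover have "torus_integral (\<lambda>x. E x - m x) = torus_integral E - torus_integral m"
    by (subst integral_diff) (auto intro!: ci)
  moreover have "\<bar>torus_integral m - 1\<bar> \<le> sqrt \<epsilon>" using mass by (metis real_sqrt_abs real_sqrt_le_iff)
  ultimately show s1: "\<bar>s - 1\<bar> \<le> 2 * sqrt \<epsilon> + \<delta>" using up lo by linarith
  have "torus_integral (\<lambda>x. \<bar>m x - h x\<bar>)
          \<le> torus_integral (\<lambda>x. \<bar>E x - m x\<bar> + (E x - s * h x) + \<bar>s - 1\<bar> * h x)"
  proof (intro integral_le ci)
    fix x
    have "s * h x - h x = (s - 1) * h x" by (simp add: algebra_simps)
    then have "\<bar>s * h x - h x\<bar> = \<bar>s - 1\<bar> * h x" using h(1)[of x] by (simp add: abs_mult)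
    then show "\<bar>m x - h x\<bar> \<le> \<bar>E x - m x\<bar> + (E x - s * h x) + \<bar>s - 1\<bar> * h x"
      using lower[of x] by linarith
  qed
  also have "\<dots> = torus_integral (\<lambda>x. \<bar>E x - m x\<bar>) + (torus_integral E - s) + \<bar>s - 1\<bar>"
    using h(2) by (simp add: integral_add integral_diff ci)
  also have "\<dots> \<le> 3 * sqrt \<epsilon> + 2 * \<delta>" using r1'(1) up s1 by linarith
  finally show "torus_integral (\<lambda>x. \<bar>m x - h x\<bar>) \<le> 3 * sqrt \<epsilon> + 2 * \<delta>" .
qed

text \<open>The bounds depend on \<open>H\<close> only through \<open>\<kappa>\<close>, so they are uniform over any family of
  approximate solutions for which \<open>H\<close> is bounded from above.\<close>

theorem residual_stability:
  assumes b: "smooth_torus b" "torus_integral b = 0" and sol: "mfg_solution V b us ms Hs"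
    and u: "trig_poly u" and m: "trig_poly m"
    and "\<kappa> > 0" and \<kappa>: "\<And>x. x \<in> {0..1} \<Longrightarrow> \<kappa> \<le> exp (Hs - H) * ms x"
    and Q: "residual_Q V b u m H \<le> \<epsilon>"
  shows "H1_norm_torus (\<lambda>x. u x - us x) \<le> sqrt (2 * \<epsilon> + 12 * \<epsilon> / \<kappa>\<^sup>2)"
    and "L1_norm_torus (\<lambda>x. m x - ms x) \<le> 3 * sqrt \<epsilon> + 4 * \<epsilon> / \<kappa>"
    and "\<bar>exp (Hs - H) - 1\<bar> \<le> 2 * sqrt \<epsilon> + 2 * \<epsilon> / \<kappa>"
proof -
  have sm: "smooth_torus us" "smooth_torus ms" and pos: "\<And>x. ms x > 0"
    and mass: "torus_integral ms = 1" and mean: "torus_integral us = 0"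
    using sol unfolding mfg_solution_def by auto
  have us': "deriv us x = - b x" for x by (rule mfg_solution_deriv[OF b sol])
  define w where "w = (\<lambda>x. deriv u x + b x)"
  define w' where "w' = (\<lambda>x. deriv (deriv u) x + deriv b x)"
  define E where "E = (\<lambda>x. exp (Hs - H) * ms x * exp ((w x)\<^sup>2 / 2))"
  note u' = trig_poly_deriv(1)[OF u] and m' = trig_poly_deriv(1)[OF m]
  note u'' = trig_poly_deriv(1)[OF u']
  have w: "(w has_real_derivative w' x) (at x)" for x
    unfolding w_def w'_def
    using trig_poly_deriv(2)[OF u'] smooth_torus_DERIV[OF b(1)] by (auto intro!: derivative_eq_intros)
  have v: "((\<lambda>x. u x - us x) has_real_derivative w x) (at x)" for x
    unfolding w_def using trig_poly_deriv(2)[OF u, of x] smooth_torus_DERIV[OF sm(1), of x] us'[of x]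
    by (auto intro!: derivative_eq_intros)
  have cw: "continuous_on {0..1} w" and cw': "continuous_on {0..1} w'"
    and cm: "continuous_on {0..1} m" and cm': "continuous_on {0..1} (deriv m)"
    and cms: "continuous_on {0..1} ms" and cus: "continuous_on {0..1} us" and cu: "continuous_on {0..1} u"
    unfolding w_def w'_def
    by (intro continuous_intros trig_poly_continuous u u' u'' m m' smooth_torus_continuous sm b
        smooth_torus_deriv)+
  have cE: "continuous_on {0..1} E" unfolding E_def by (auto intro!: continuous_intros cw cms)
  note ci = integrable_continuous_real continuous_intros cm cm' cw cw' cE cms cus cu
  have Qeq: "residual_Q V b u m H = torus_integral (\<lambda>x. (E x - m x)\<^sup>2) + (torus_integral u)\<^sup>2
       + (torus_integral m - 1)\<^sup>2 + torus_integral (\<lambda>x. (m x * w' x + deriv m x * w x)\<^sup>2)"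
    unfolding residual_Q_def mfg_solution_hamiltonian[OF b sol] E_def w_def w'_def by simp
  have "torus_integral (\<lambda>x. (E x - m x)\<^sup>2) \<ge> 0"
    "torus_integral (\<lambda>x. (m x * w' x + deriv m x * w x)\<^sup>2) \<ge> 0"
    by (simp_all add: torus_integral_nonneg)
  with Q have r1: "torus_integral (\<lambda>x. (E x - m x)\<^sup>2) \<le> \<epsilon>"
    and r2: "torus_integral (\<lambda>x. (m x * w' x + deriv m x * w x)\<^sup>2) \<le> \<epsilon>"
    and r3: "(torus_integral u)\<^sup>2 \<le> \<epsilon>" and r4: "(torus_integral m - 1)\<^sup>2 \<le> \<epsilon>"
    unfolding Qeq
    using zero_le_power2[of "torus_integral u"] zero_le_power2[of "torus_integral m - 1"] by linarith+
  have "(w has_integral (u 1 - us 1) - (u 0 - us 0)) {0..1}"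
    using v by (intro fundamental_theorem_of_calculus)
      (auto simp: has_real_derivative_iff_has_vector_derivative[symmetric] intro: DERIV_subset)
  then have "torus_integral w = 0"
    using trig_poly_periodic[OF u, of 0] smooth_torus_periodic[OF sm(1), of 0]
    by (simp add: integral_unique)
  note vel = velocity_estimate[of m "deriv m" w w' "\<lambda>x. exp (Hs - H) * ms x" \<kappa> \<epsilon>,
      OF trig_poly_deriv(2)[OF m] w cm' cw' _ \<open>\<kappa> > 0\<close> \<kappa> this r1[unfolded E_def] r2]
  have Ew: "torus_integral (\<lambda>x. E x * (w x)\<^sup>2) \<le> 2 * (2 * \<epsilon> / \<kappa>)"
    and ww: "torus_integral (\<lambda>x. (w x)\<^sup>2) \<le> 4 * \<epsilon> / \<kappa>\<^sup>2"
    using vel by (simp_all add: E_def ci)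
  note den = density_estimate[of m w ms "exp (Hs - H)" "2 * \<epsilon> / \<kappa>" \<epsilon>,
      OF cm cw cms _ pos mass Ew[unfolded E_def] r1[unfolded E_def] r4]
  show "\<bar>exp (Hs - H) - 1\<bar> \<le> 2 * sqrt \<epsilon> + 2 * \<epsilon> / \<kappa>"
    using den(1) by simp
  show "L1_norm_torus (\<lambda>x. m x - ms x) \<le> 3 * sqrt \<epsilon> + 4 * \<epsilon> / \<kappa>"
    unfolding L1_norm_torus_def using den(2) by simp
  have "torus_integral (\<lambda>x. u x - us x) = torus_integral u"
    using mean by (subst integral_diff) (auto intro!: ci)
  then have "torus_integral (\<lambda>x. (u x - us x)\<^sup>2)
               \<le> 2 * (torus_integral u)\<^sup>2 + 2 * torus_integral (\<lambda>x. (w x)\<^sup>2)"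
    using poincare_torus[OF v cw] by simp
  moreover have "deriv (\<lambda>x. u x - us x) = w" using v by (auto simp: DERIV_imp_deriv)
  moreover have "12 * \<epsilon> / \<kappa>\<^sup>2 = 3 * (4 * \<epsilon> / \<kappa>\<^sup>2)" by simp
  ultimately show "H1_norm_torus (\<lambda>x. u x - us x) \<le> sqrt (2 * \<epsilon> + 12 * \<epsilon> / \<kappa>\<^sup>2)"
    unfolding H1_norm_torus_def using ww r3 by (intro real_sqrt_le_mono) simp
qed

section \<open>Competitors with small residual\<close>

lemma trig_poly_approx_C1:
  assumes f: "smooth_torus f" and "e > 0"
  obtains p where "trig_poly p" "\<And>x. \<bar>f x - p x\<bar> \<le> e" "\<And>x. \<bar>deriv f x - deriv p x\<bar> \<le> e"
proof -
  obtain q where q: "trig_poly q" "\<And>x. \<bar>deriv f x - q x\<bar> < e / 2"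
    using trig_poly_dense[of "deriv f" "e / 2"] \<open>e > 0\<close>
      smooth_torus_continuous smooth_torus_periodic smooth_torus_deriv[OF f] by auto
  obtain P c where P: "trig_poly P" "\<And>x. (P has_real_derivative q x - c) (at x)"
      "\<And>x. \<bar>deriv f x - (q x - c)\<bar> \<le> 2 * (e / 2)" "\<And>x. \<bar>f x - P x\<bar> \<le> 2 * (e / 2)"
    using trig_poly_approx_antiderivative[OF smooth_torus_DERIV[OF f] smooth_torus_periodic[OF f] q(1)
        less_imp_le[OF q(2)]] by blast
  then show ?thesis by (intro that[of P]) (auto simp: DERIV_imp_deriv[OF P(2)])
qed

text \<open>Integrating a \<open>C\<^sup>1\<close> approximation \<open>q\<close> of the derivative changes it by a constant only, so the second
  derivative of the result is still the derivative of \<open>q\<close>.\<close>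

lemma trig_poly_approx_C2:
  assumes f: "smooth_torus f" and "e > 0"
  obtains p where "trig_poly p" "\<And>x. \<bar>f x - p x\<bar> \<le> e" "\<And>x. \<bar>deriv f x - deriv p x\<bar> \<le> e"
    "\<And>x. \<bar>deriv (deriv f) x - deriv (deriv p) x\<bar> \<le> e"
proof -
  obtain q where q: "trig_poly q" "\<And>x. \<bar>deriv f x - q x\<bar> \<le> e / 2"
      "\<And>x. \<bar>deriv (deriv f) x - deriv q x\<bar> \<le> e / 2"
    using trig_poly_approx_C1[OF smooth_torus_deriv[OF f], of "e / 2"] \<open>e > 0\<close> by auto
  obtain P c where P: "trig_poly P" "\<And>x. (P has_real_derivative q x - c) (at x)"
      "\<And>x. \<bar>deriv f x - (q x - c)\<bar> \<le> 2 * (e / 2)" "\<And>x. \<bar>f x - P x\<bar> \<le> 2 * (e / 2)"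
    using trig_poly_approx_antiderivative[OF smooth_torus_DERIV[OF f] smooth_torus_periodic[OF f] q(1,2)] by blast
  have P': "deriv P = (\<lambda>x. q x - c)" using P(2) by (auto simp: DERIV_imp_deriv)
  have "((\<lambda>x. q x - c) has_real_derivative deriv q x) (at x)" for x
    using trig_poly_deriv(2)[OF q(1), of x] by (auto intro!: derivative_eq_intros)
  then have P'': "deriv (deriv P) x = deriv q x" for x by (simp add: P' DERIV_imp_deriv)
  have "\<bar>deriv (deriv f) x - deriv q x\<bar> \<le> e" for x
    using q(3)[of x] \<open>e > 0\<close> by linarith
  with P show ?thesis by (intro that[of P]) (auto simp: P' P''[unfolded P'])
qed

lemma torus_integral_square_le:
  fixes g :: "real \<Rightarrow> real"
  assumes g: "continuous_on {0..1} g" and bd: "\<And>x. x \<in> {0..1} \<Longrightarrow> \<bar>g x\<bar> \<le> B"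
  shows "torus_integral (\<lambda>x. \<bar>g x\<bar>\<^sup>2) \<le> B\<^sup>2"
proof -
  have "torus_integral (\<lambda>x. \<bar>g x\<bar>\<^sup>2) \<le> torus_integral (\<lambda>x. B\<^sup>2)"
  proof (intro integral_le integrable_continuous_real continuous_intros g)
    show "\<bar>g x\<bar>\<^sup>2 \<le> B\<^sup>2" if "x \<in> {0..1}" for x using bd[OF that] by (intro power_mono) auto
  qed
  then show ?thesis by simp
qed

lemma square_torus_integral_diff_le:
  fixes f g :: "real \<Rightarrow> real"
  assumes f: "continuous_on {0..1} f" and g: "continuous_on {0..1} g"
    and bd: "\<And>x. x \<in> {0..1} \<Longrightarrow> \<bar>f x - g x\<bar> \<le> B"
  shows "(torus_integral g - torus_integral f)\<^sup>2 \<le> B\<^sup>2"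
proof -
  have c: "continuous_on {0..1} (\<lambda>x. f x - g x)" by (intro continuous_intros f g)
  have "torus_integral (\<lambda>x. (f x - g x)\<^sup>2) \<le> B\<^sup>2"
    using torus_integral_square_le[OF c, of B] bd by simp
  note le = abs_torus_integral_le_sqrt(2)[OF c this]
  have "(torus_integral f - torus_integral g)\<^sup>2 = \<bar>torus_integral (\<lambda>x. f x - g x)\<bar>\<^sup>2"
    by (subst integral_diff) (auto intro!: integrable_continuous_real f g)
  also have "\<dots> \<le> (sqrt (B\<^sup>2))\<^sup>2"
    using le by (intro power_mono) auto
  finally show ?thesis by (simp add: power2_commute)
qed

lemma continuous_bounded_unit_interval:
  fixes f :: "real \<Rightarrow> real"
  assumes "continuous_on {0..1} f"
  obtains K where "K \<ge> 0" "\<And>x. x \<in> {0..1} \<Longrightarrow> \<bar>f x\<bar> \<le> K"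
proof -
  have "bounded (f ` {0..1})" using assms by (intro compact_imp_bounded compact_continuous_image) auto
  then obtain K where K: "\<forall>x\<in>{0..1}. \<bar>f x\<bar> \<le> K" by (auto simp: bounded_iff)
  then have "\<bar>f 0\<bar> \<le> K" by simp
  then have "K \<ge> 0" by linarith
  with K show ?thesis by (intro that[of K]) auto
qed

text \<open>If \<open>u\<close> and \<open>m\<close> are \<open>\<delta>\<close>-close to \<open>us\<close> with two derivatives and to \<open>ms\<close> with one, then the velocity
  \<open>u\<^sub>x + b\<close> and its derivative are at most \<open>\<delta>\<close>, because \<open>us\<^sub>x = - b\<close>. Each expression that is squared in the
  residual is therefore bounded by a multiple of \<open>\<delta>\<close>, and the residual is \<open>O(\<delta>\<^sup>2)\<close>. The bound \<open>C\<close> may be chosen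
  before \<open>\<eta>\<close> since \<open>\<delta> \<le> 1\<close>.\<close>

lemma residual_competitor:
  assumes b: "smooth_torus b" "torus_integral b = 0" and sol: "mfg_solution V b us ms Hs"
  obtains C where "C \<ge> 0" "\<And>\<eta>. \<eta> > 0 \<Longrightarrow> \<exists>N u m. N \<ge> 1 \<and> u \<in> trig_polys N \<and> m \<in> trig_polys N \<and>
      residual_Q V b u m Hs \<le> \<eta> \<and>
      torus_integral (\<lambda>x. \<bar>u x\<bar>\<^sup>2) + torus_integral (\<lambda>x. \<bar>m x\<bar>\<^sup>2) + Hs\<^sup>2 \<le> C"
proof -
  have sm: "smooth_torus us" "smooth_torus ms"
    and mass: "torus_integral ms = 1" and mean: "torus_integral us = 0"
    using sol unfolding mfg_solution_def by auto
  have us': "deriv us x = - b x" for x by (rule mfg_solution_deriv[OF b sol])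
  have us'': "deriv (deriv us) x = - deriv b x" for x
  proof -
    have "deriv us = (\<lambda>x. - b x)" by (rule ext) (rule us')
    then show ?thesis using DERIV_imp_deriv[OF DERIV_minus[OF smooth_torus_DERIV[OF b(1), of x]]] by simp
  qed
  obtain K1 where K1: "K1 \<ge> 0" "\<And>x. x \<in> {0..1} \<Longrightarrow> \<bar>us x\<bar> \<le> K1"
    using continuous_bounded_unit_interval[OF smooth_torus_continuous[OF sm(1)]] by blast
  obtain K2 where K2: "K2 \<ge> 0" "\<And>x. x \<in> {0..1} \<Longrightarrow> \<bar>ms x\<bar> \<le> K2"
    using continuous_bounded_unit_interval[OF smooth_torus_continuous[OF sm(2)]] by blast
  obtain K3 where K3: "K3 \<ge> 0" "\<And>x. x \<in> {0..1} \<Longrightarrow> \<bar>deriv ms x\<bar> \<le> K3"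
    using continuous_bounded_unit_interval[OF smooth_torus_continuous[OF smooth_torus_deriv[OF sm(2)]]] by blast
  define L where "L = K1 + K2 + K3 + 1"
  have L: "L \<ge> 1" using K1(1) K2(1) K3(1) by (simp add: L_def)
  have Lb: "\<bar>us x\<bar> \<le> L - 1" "\<bar>ms x\<bar> \<le> L - 1" "\<bar>deriv ms x\<bar> \<le> L - 1" if "x \<in> {0..1}" for x
    using K1(1) K2(1) K3(1) K1(2)[OF that] K2(2)[OF that] K3(2)[OF that] unfolding L_def by linarith+
  show ?thesis
  proof (rule that[of "2 * L\<^sup>2 + Hs\<^sup>2"])
    show "0 \<le> 2 * L\<^sup>2 + Hs\<^sup>2" by simp
    fix \<eta> :: real assume "\<eta> > 0"
    define \<delta> where "\<delta> = min 1 (\<eta> / (7 * L\<^sup>2))"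
    have \<delta>: "\<delta> > 0" "\<delta> \<le> 1" using \<open>\<eta> > 0\<close> L by (auto simp: \<delta>_def)
    have \<delta>2: "7 * L\<^sup>2 * \<delta>\<^sup>2 \<le> \<eta>"
    proof -
      have "\<delta>\<^sup>2 \<le> \<delta>" using \<delta> by (simp add: power2_eq_square mult_left_le)
      also have "\<delta> \<le> \<eta> / (7 * L\<^sup>2)" by (simp add: \<delta>_def)
      finally show ?thesis using L by (simp add: field_simps)
    qed
    obtain u where u: "trig_poly u" "\<And>x. \<bar>us x - u x\<bar> \<le> \<delta>" "\<And>x. \<bar>deriv us x - deriv u x\<bar> \<le> \<delta>"
      "\<And>x. \<bar>deriv (deriv us) x - deriv (deriv u) x\<bar> \<le> \<delta>"
      using trig_poly_approx_C2[OF sm(1) \<delta>(1)] by blast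
    obtain m where m: "trig_poly m" "\<And>x. \<bar>ms x - m x\<bar> \<le> \<delta>" "\<And>x. \<bar>deriv ms x - deriv m x\<bar> \<le> \<delta>"
      using trig_poly_approx_C1[OF sm(2) \<delta>(1)] by blast
    note u' = trig_poly_deriv(1)[OF u(1)] and m' = trig_poly_deriv(1)[OF m(1)]
    note u'' = trig_poly_deriv(1)[OF u']
    define w where "w = (\<lambda>x. deriv u x + b x)"
    define w' where "w' = (\<lambda>x. deriv (deriv u) x + deriv b x)"
    have w: "\<bar>w x\<bar> \<le> \<delta>" "\<bar>w' x\<bar> \<le> \<delta>" for x
      using u(3)[of x] u(4)[of x] us'[of x] us''[of x] unfolding w_def w'_def by linarith+
    have cw: "continuous_on {0..1} w" "continuous_on {0..1} w'"
      unfolding w_def w'_def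
      by (intro continuous_intros trig_poly_continuous u' u'' smooth_torus_continuous b smooth_torus_deriv)+
    note ci = continuous_intros cw smooth_torus_continuous[OF sm(1)] smooth_torus_continuous[OF sm(2)]
      trig_poly_continuous[OF u(1)] trig_poly_continuous[OF m(1)] trig_poly_continuous[OF m']
    have mb: "\<bar>m x\<bar> \<le> L" "\<bar>deriv m x\<bar> \<le> L" "\<bar>u x\<bar> \<le> L" if "x \<in> {0..1}" for x
      using m(2)[of x] m(3)[of x] u(2)[of x] Lb[OF that] \<delta>(2) by linarith+
    have e1: "\<bar>ms x * exp ((w x)\<^sup>2 / 2) - m x\<bar> \<le> L * \<delta>" if x: "x \<in> {0..1}" for x
    proof -
      define t where "t = (w x)\<^sup>2 / 2"
      have "(w x)\<^sup>2 \<le> \<delta>\<^sup>2" using w(1)[of x] by (metis abs_ge_zero power2_abs power_mono)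
      also have "\<delta>\<^sup>2 \<le> \<delta>" using \<delta> by (simp add: power2_eq_square mult_left_le)
      finally have t: "0 \<le> t" "2 * t \<le> \<delta>" unfolding t_def by simp_all
      \<comment> \<open>As \<open>t \<le> 1/2\<close>, this gives \<open>exp t - 1 \<le> exp t / 2\<close>, that is \<open>exp t \<le> 2\<close>; inserting
        this bound back into the same inequality makes \<open>exp t - 1\<close> linear in \<open>t\<close>.\<close>
      have "exp t - 1 \<le> t * exp t" by (rule exp_minus_one_le)
      moreover have "t * exp t \<le> 1 / 2 * exp t" using t \<delta> by (intro mult_right_mono) auto
      ultimately have "exp t \<le> 2" by linarith
      then have "t * exp t \<le> t * 2" using t by (intro mult_left_mono) auto
      with \<open>exp t - 1 \<le> t * exp t\<close> t have "\<bar>exp t - 1\<bar> \<le> \<delta>" by simp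
      then have "\<bar>ms x * (exp t - 1)\<bar> \<le> (L - 1) * \<delta>"
        unfolding abs_mult using Lb(2)[OF x] by (intro mult_mono) auto
      moreover have "ms x * exp t - m x = ms x * (exp t - 1) + (ms x - m x)" by (simp add: algebra_simps)
      ultimately have "\<bar>ms x * exp t - m x\<bar> \<le> (L - 1) * \<delta> + \<delta>" using m(2)[of x] by linarith
      then show ?thesis by (simp add: t_def algebra_simps)
    qed
    have e2: "\<bar>m x * w' x + deriv m x * w x\<bar> \<le> 2 * L * \<delta>" if x: "x \<in> {0..1}" for x
    proof -
      have "\<bar>m x * w' x\<bar> \<le> L * \<delta>" "\<bar>deriv m x * w x\<bar> \<le> L * \<delta>"
        unfolding abs_mult using mb[OF x] w[of x] L by (intro mult_mono; simp)+
      then show ?thesis by linarith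
    qed
    have "torus_integral (\<lambda>x. \<bar>ms x * exp ((w x)\<^sup>2 / 2) - m x\<bar>\<^sup>2) \<le> (L * \<delta>)\<^sup>2"
      by (rule torus_integral_square_le) (use e1 in \<open>auto intro!: ci\<close>)
    moreover have "torus_integral (\<lambda>x. \<bar>m x * w' x + deriv m x * w x\<bar>\<^sup>2) \<le> (2 * L * \<delta>)\<^sup>2"
      by (rule torus_integral_square_le) (use e2 in \<open>auto intro!: ci\<close>)
    moreover have "(torus_integral u)\<^sup>2 \<le> \<delta>\<^sup>2" "(torus_integral m - 1)\<^sup>2 \<le> \<delta>\<^sup>2"
      using square_torus_integral_diff_le[of us u \<delta>] square_torus_integral_diff_le[of ms m \<delta>]
      by (simp_all add: mean mass ci u(2) m(2))
    ultimately have "residual_Q V b u m Hs \<le> (L * \<delta>)\<^sup>2 + \<delta>\<^sup>2 + \<delta>\<^sup>2 + (2 * L * \<delta>)\<^sup>2"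
      unfolding residual_Q_def mfg_solution_hamiltonian[OF b sol] w_def w'_def by simp
    also have "\<dots> = 5 * (L\<^sup>2 * \<delta>\<^sup>2) + 2 * (1 * \<delta>\<^sup>2)" by (simp add: power_mult_distrib)
    also have "\<dots> \<le> 5 * (L\<^sup>2 * \<delta>\<^sup>2) + 2 * (L\<^sup>2 * \<delta>\<^sup>2)"
      using L by (intro add_left_mono mult_left_mono mult_right_mono) auto
    also have "\<dots> \<le> \<eta>" using \<delta>2 by simp
    finally have Q: "residual_Q V b u m Hs \<le> \<eta>" .
    have "torus_integral (\<lambda>x. \<bar>u x\<bar>\<^sup>2) \<le> L\<^sup>2" "torus_integral (\<lambda>x. \<bar>m x\<bar>\<^sup>2) \<le> L\<^sup>2"
      by (rule torus_integral_square_le; use mb in \<open>auto intro!: ci\<close>)+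
    then have J: "torus_integral (\<lambda>x. \<bar>u x\<bar>\<^sup>2) + torus_integral (\<lambda>x. \<bar>m x\<bar>\<^sup>2) + Hs\<^sup>2 \<le> 2 * L\<^sup>2 + Hs\<^sup>2"
      by simp
    obtain N1 N2 where "u \<in> trig_polys N1" "m \<in> trig_polys N2"
      using u(1) m(1) unfolding trig_poly_def by blast
    then have "u \<in> trig_polys (Suc (N1 + N2))" "m \<in> trig_polys (Suc (N1 + N2))"
      using trig_polys_mono[of N1 "Suc (N1 + N2)"] trig_polys_mono[of N2 "Suc (N1 + N2)"] by auto
    with Q J show "\<exists>N u m. N \<ge> 1 \<and> u \<in> trig_polys N \<and> m \<in> trig_polys N \<and>
      residual_Q V b u m Hs \<le> \<eta> \<and>
      torus_integral (\<lambda>x. \<bar>u x\<bar>\<^sup>2) + torus_integral (\<lambda>x. \<bar>m x\<bar>\<^sup>2) + Hs\<^sup>2 \<le> 2 * L\<^sup>2 + Hs\<^sup>2"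
      by (intro exI[of _ "Suc (N1 + N2)"] exI[of _ u] exI[of _ m]) simp
  qed
qed

section \<open>Convergence of the minimizers\<close>

theorem theorem2p8:
  fixes V b us ms :: "real \<Rightarrow> real" and Hs :: real
  assumes "smooth_torus V" and "smooth_torus b"
    and "torus_integral b = 0"
    and "mfg_solution V b us ms Hs"
  shows "\<exists>(N :: nat \<Rightarrow> nat) (\<gamma> :: nat \<Rightarrow> real).
           (\<forall>i. N i \<ge> 1 \<and> \<gamma> i > 0) \<and>
           (\<forall>(u :: nat \<Rightarrow> real \<Rightarrow> real) (m :: nat \<Rightarrow> real \<Rightarrow> real) (Hbar :: nat \<Rightarrow> real).
              (\<forall>i. is_minimizer V b (N i) (\<gamma> i) (u i) (m i) (Hbar i)) \<longrightarrow>
              (\<lambda>i. H1_norm_torus (\<lambda>x. u i x - us x)) \<longlonglongrightarrow> 0 \<and>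
              (\<lambda>i. L1_norm_torus (\<lambda>x. m i x - ms x)) \<longlonglongrightarrow> 0 \<and>
              Hbar \<longlonglongrightarrow> Hs)"
proof -
  note b = assms(2,3) and sol = assms(4)
  have ms: "smooth_torus ms" and pos: "\<And>x. ms x > 0"
    using sol unfolding mfg_solution_def by auto
  obtain C where "C \<ge> 0" and C: "\<And>\<eta>. \<eta> > 0 \<Longrightarrow> \<exists>N u m. N \<ge> 1 \<and> u \<in> trig_polys N \<and>
      m \<in> trig_polys N \<and> residual_Q V b u m Hs \<le> \<eta> \<and>
      torus_integral (\<lambda>x. \<bar>u x\<bar>\<^sup>2) + torus_integral (\<lambda>x. \<bar>m x\<bar>\<^sup>2) + Hs\<^sup>2 \<le> C"
    using residual_competitor[OF b sol] by blast
  define \<gamma> where "\<gamma> i = real (Suc i)" for i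
  have \<gamma>: "\<gamma> i > 0" for i by (simp add: \<gamma>_def)
  have "\<forall>i. \<exists>N u m. N \<ge> 1 \<and> u \<in> trig_polys N \<and>
      m \<in> trig_polys N \<and> residual_Q V b u m Hs \<le> 1 / \<gamma> i \<and>
      torus_integral (\<lambda>x. \<bar>u x\<bar>\<^sup>2) + torus_integral (\<lambda>x. \<bar>m x\<bar>\<^sup>2) + Hs\<^sup>2 \<le> C"
    using C \<gamma> by simp
  then obtain N uc mc where N: "\<And>i. N i \<ge> (1::nat)" and c: "\<And>i. uc i \<in> trig_polys (N i)"
      "\<And>i. mc i \<in> trig_polys (N i)" "\<And>i. residual_Q V b (uc i) (mc i) Hs \<le> 1 / \<gamma> i"
      "\<And>i. torus_integral (\<lambda>x. \<bar>uc i x\<bar>\<^sup>2) + torus_integral (\<lambda>x. \<bar>mc i x\<bar>\<^sup>2) + Hs\<^sup>2 \<le> C"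
    by metis
  have "\<exists>x0\<in>{0..1}. \<forall>x\<in>{0..1}. ms x0 \<le> ms x"
    by (intro continuous_attains_inf smooth_torus_continuous ms) auto
  then obtain x0 where x0: "\<forall>x\<in>{0..1}. ms x0 \<le> ms x" by blast
  \<comment> \<open>The objective at a minimizer is at most \<open>C + 1\<close>, so its \<open>H\<close> has square at most \<open>C + 1\<close> and is
    below \<open>C + 2\<close>. This makes \<open>\<kappa>\<close> a lower bound for \<open>exp (Hs - H) ms\<close> for all minimizers at once.\<close>
  define \<kappa> where "\<kappa> = exp (Hs - (C + 2)) * ms x0"
  have "\<kappa> > 0" using pos by (simp add: \<kappa>_def)
  define \<epsilon> where "\<epsilon> i = (C + 1) / \<gamma> i" for i
  have "(\<lambda>i. inverse (real (Suc i))) \<longlonglongrightarrow> 0" by (rule LIMSEQ_inverse_real_of_nat)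
  then have \<epsilon>: "\<epsilon> \<longlonglongrightarrow> 0"
    unfolding \<epsilon>_def \<gamma>_def divide_inverse by (intro tendsto_mult_right_zero)
  have "(\<lambda>i. H1_norm_torus (\<lambda>x. u i x - us x)) \<longlonglongrightarrow> 0 \<and>
        (\<lambda>i. L1_norm_torus (\<lambda>x. m i x - ms x)) \<longlonglongrightarrow> 0 \<and> H \<longlonglongrightarrow> Hs"
    if min: "\<forall>i. is_minimizer V b (N i) (\<gamma> i) (u i) (m i) (H i)" for u m H
  proof -
    have tu: "trig_poly (u i)" and tm: "trig_poly (m i)" for i
      using min unfolding is_minimizer_def trig_poly_def by blast+
    have bound: "(H i)\<^sup>2 + \<gamma> i * residual_Q V b (u i) (m i) (H i) \<le> C + 1" for i
    proof -
      have "objective_J V b (\<gamma> i) (u i) (m i) (H i) \<le> objective_J V b (\<gamma> i) (uc i) (mc i) Hs"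
        using min c(1,2) unfolding is_minimizer_def by blast
      also have "\<dots> \<le> C + \<gamma> i * (1 / \<gamma> i)"
        unfolding objective_J_def using c(3,4)[of i] \<gamma>[of i]
        by (intro add_mono mult_left_mono) auto
      finally have "objective_J V b (\<gamma> i) (u i) (m i) (H i) \<le> C + 1" using \<gamma>[of i] by simp
      moreover have "torus_integral (\<lambda>x. \<bar>u i x\<bar>\<^sup>2) \<ge> 0" "torus_integral (\<lambda>x. \<bar>m i x\<bar>\<^sup>2) \<ge> 0"
        by (simp_all add: torus_integral_nonneg)
      ultimately show ?thesis unfolding objective_J_def by linarith
    qed
    have Q0: "residual_Q V b (u i) (m i) (H i) \<ge> 0" for i
      unfolding residual_Q_def by (intro add_nonneg_nonneg torus_integral_nonneg) auto
    have Q: "residual_Q V b (u i) (m i) (H i) \<le> \<epsilon> i" for i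
    proof -
      have "\<gamma> i * residual_Q V b (u i) (m i) (H i) \<le> C + 1"
        using bound[of i] zero_le_power2[of "H i"] by linarith
      then show ?thesis unfolding \<epsilon>_def using \<gamma>[of i] by (simp add: pos_le_divide_eq mult.commute)
    qed
    have H: "H i \<le> C + 2" for i
    proof -
      have "(H i)\<^sup>2 \<le> C + 1" using bound[of i] mult_nonneg_nonneg[OF less_imp_le[OF \<gamma>[of i]] Q0[of i]] by linarith
      also have "\<dots> \<le> (C + 2)\<^sup>2" using \<open>C \<ge> 0\<close> by (simp add: power2_eq_square algebra_simps)
      finally show ?thesis by (rule power2_le_imp_le) (use \<open>C \<ge> 0\<close> in simp)
    qed
    have \<kappa>: "\<kappa> \<le> exp (Hs - H i) * ms x" if "x \<in> {0..1}" for x i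
      unfolding \<kappa>_def using H[of i] bspec[OF x0 that] pos[of x0] by (intro mult_mono) auto
    note stab = residual_stability[OF b sol tu tm \<open>\<kappa> > 0\<close> \<kappa> Q]
    have sq: "(\<lambda>i. sqrt (\<epsilon> i)) \<longlonglongrightarrow> 0" using tendsto_real_sqrt[OF \<epsilon>] by simp
    have squeeze: "f \<longlonglongrightarrow> 0" if "\<And>i. 0 \<le> f i" "\<And>i. f i \<le> g i" "g \<longlonglongrightarrow> 0" for f g :: "nat \<Rightarrow> real"
      using that by (intro tendsto_sandwich[OF _ _ tendsto_const that(3)]) auto
    have "(\<lambda>i. sqrt (2 * \<epsilon> i + 12 * \<epsilon> i / \<kappa>\<^sup>2)) \<longlonglongrightarrow> 0"
      using \<open>\<kappa> > 0\<close> by (auto intro!: tendsto_eq_intros \<epsilon>)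
    moreover have "0 \<le> H1_norm_torus f" for f
      unfolding H1_norm_torus_def by (intro real_sqrt_ge_zero add_nonneg_nonneg torus_integral_nonneg) auto
    ultimately have lim_u: "(\<lambda>i. H1_norm_torus (\<lambda>x. u i x - us x)) \<longlonglongrightarrow> 0"
      using stab(1) by (rule squeeze[rotated 2])
    have "(\<lambda>i. 3 * sqrt (\<epsilon> i) + 4 * \<epsilon> i / \<kappa>) \<longlonglongrightarrow> 0"
      using \<open>\<kappa> > 0\<close> by (auto intro!: tendsto_eq_intros \<epsilon> sq)
    moreover have "0 \<le> L1_norm_torus f" for f
      unfolding L1_norm_torus_def by (intro torus_integral_nonneg) auto
    ultimately have lim_m: "(\<lambda>i. L1_norm_torus (\<lambda>x. m i x - ms x)) \<longlonglongrightarrow> 0"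
      using stab(2) by (rule squeeze[rotated 2])
    have "(\<lambda>i. 2 * sqrt (\<epsilon> i) + 2 * \<epsilon> i / \<kappa>) \<longlonglongrightarrow> 0"
      using \<open>\<kappa> > 0\<close> by (auto intro!: tendsto_eq_intros \<epsilon> sq)
    then have "(\<lambda>i. \<bar>exp (Hs - H i) - 1\<bar>) \<longlonglongrightarrow> 0"
      using stab(3) by (intro squeeze[of "\<lambda>i. \<bar>exp (Hs - H i) - 1\<bar>"]) auto
    then have "(\<lambda>i. exp (Hs - H i)) \<longlonglongrightarrow> 1"
      by (simp add: tendsto_rabs_zero_iff LIM_zero_iff)
    then have "(\<lambda>i. Hs - ln (exp (Hs - H i))) \<longlonglongrightarrow> Hs - ln 1"
      by (intro tendsto_diff tendsto_const tendsto_ln) auto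
    then have "H \<longlonglongrightarrow> Hs" by simp
    with lim_u lim_m show ?thesis by blast
  qed
  with N \<gamma> show ?thesis by blast
qed

end
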